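(* Let $x\in\mathbb Q$ and let $q\in\mathbb C$ with $|q|=1$. (i) If $q\in C_-$, then $$|T_x(q)|+(1-q^{-1}-q)\,|S_x(q)|\le|1-q|^3.$$ At the endpoints $q=e^{\pm\pi i/3}$ this turns into the equality $|T_x(q)|=1$. (ii) If $q\in C_+$, then $$|T_x(q)|\ge\sqrt{q+q^{-1}-1}\;|S_x(q)|,$$ i.e. if $S_x(q)\ne0$ then $\bigl|(1-q)[x]_q-1\bigr|\ge\sqrt{q+q^{-1}-1}$. (iii) Suppose in addition that $q$ is not a root of unity. Then the closure of $X_q:=\{[y]_q: y\in\mathbb Q\}$ in $\mathbb C\mathbb P^1$ is $$\overline{X_q}=\begin{cases}\mathbb C\mathbb P^1,& q\in C_-,\\ \{z\in\mathbb C\mathbb P^1:\ |(1-q)z-1|\ge\sqrt{q+q^{-1}-1}\},& q\in C_+.\end{cases}$$ In particular, for $q\in C_+$ not a root of unity the boundary circle $|(1-q)z-1|=\sqrt{q+q^{-1}-1}$ lies in $\overline{X_q}$, so the constants in (ii) are sharp.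
   Context: $C_-:=\{q\in\mathbb C:|q|=1,\ \mathrm{Re}\,q\le\frac12\}$ and $C_+:=\{q\in\mathbb C:|q|=1,\ \mathrm{Re}\,q>\frac12\}$; $[n]_q$ denotes the Laurent polynomial $\frac{1-q^n}{1-q}$, $n\in\mathbb Z$. Every rational $x>1$ is uniquely $x=[[c_1,\ldots,c_N]]:=c_1-\frac1{c_2-\cdots\frac1{c_N}}$ with integers $c_i\ge2$. For such $x$ put $R_x(q)=a_N(q)$, $S_x(q)=b_N(q)$, where $a_j,b_j$ both satisfy the recursion $u_j=[c_j]_qu_{j-1}-q^{c_{j-1}-1}u_{j-2}$ ($j\ge2$) with $a_0=1$, $a_1=[c_1]_q$, $b_0=0$, $b_1=1$. For arbitrary $x\in\mathbb Q$ choose an integer $n$ with $x+n>1$ and define $S_x,R_x$ by $S_{x+n}(q)=S_x(q)$, $R_{x+n}(q)=q^nR_x(q)+[n]_qS_x(q)$ (independent of $n$). The $q$-rational number is $[x]_q=R_x(q)/S_x(q)$, regarded for a given $q$ as the point $[R_x(q):S_x(q)]\in\mathbb C\mathbb P^1$. Put $T_x(q):=(1-q)R_x(q)-S_x(q)$. The point $\infty\in\mathbb C\mathbb P^1$ is understood to satisfy the inequality defining the second set in (iii). *)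

theory Defs
  imports "HOL-Analysis.Analysis"
begin

section \<open>The arcs of the unit circle and \<open>q\<close>-integers\<close>

definition C_minus :: "complex set" where
  "C_minus = {q. cmod q = 1 \<and> Re q \<le> 1 / 2}"

definition C_plus :: "complex set" where
  "C_plus = {q. cmod q = 1 \<and> Re q > 1 / 2}"

definition root_of_unity :: "complex \<Rightarrow> bool" where
  "root_of_unity q \<longleftrightarrow> (\<exists>n::nat. n > 0 \<and> q ^ n = 1)"

text \<open>
  The value at \<open>q\<close> of the Laurent polynomial \<open>(1 - q^n) / (1 - q)\<close>; expanding the quotient also
  gives the right value \<open>n\<close> at \<open>q = 1\<close>, cf. lemmas \<open>qint_eq\<close> and \<open>qint_one\<close>.
\<close>
definition qint :: "complex \<Rightarrow> int \<Rightarrow> complex" where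
  "qint q n = (if n \<ge> 0 then \<Sum>k\<in>{0..<n}. q powi k else - (\<Sum>k\<in>{n..<0}. q powi k))"

lemma qint_nat_Suc: "qint q (int (Suc k)) = qint q (int k) + q ^ k"
proof -
  have "{0..<int (Suc k)} = insert (int k) {0..<int k}" by auto
  then show ?thesis by (simp add: qint_def)
qed

lemma qint_neg_Suc: "qint q (- int (Suc k)) = qint q (- int k) - q powi (- int (Suc k))"
proof -
  have "{- int (Suc k)..<0} = insert (- int (Suc k)) {- int k..<0}" by auto
  then show ?thesis by (simp add: qint_def)
qed

lemma qint_eq:
  assumes "q \<noteq> 0" "q \<noteq> 1"
  shows "qint q n = (1 - q powi n) / (1 - q)"
proof (cases n rule: int_cases2)
  case (nonneg k)
  have "(1 - q) * qint q (int k) = 1 - q ^ k"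
  proof (induction k)
    case (Suc k)
    have "(1 - q) * qint q (int (Suc k)) = (1 - q) * qint q (int k) + (1 - q) * q ^ k"
      by (simp only: qint_nat_Suc distrib_left)
    then show ?case unfolding Suc by (simp add: algebra_simps)
  qed (simp add: qint_def)
  then have "qint q (int k) = (1 - q ^ k) / (1 - q)"
    using assms by (simp add: field_simps)
  then show ?thesis using nonneg by simp
next
  case (nonpos k)
  have "qint q (- int k) = (1 - q powi (- int k)) / (1 - q)"
  proof (induction k)
    case (Suc k)
    have "q powi (- int k) = q * q powi (- int (Suc k))"
      using assms power_int_add[of q 1 "- int (Suc k)"] by simp
    then show ?case
      using Suc assms by (simp add: qint_neg_Suc field_simps del: of_nat_Suc)
  qed (simp add: qint_def)
  then show ?thesis using nonpos by simp
qed

lemma qint_one: "qint 1 n = of_int n"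
  by (simp add: qint_def)

lemma qint_add:
  assumes "q \<noteq> 0"
  shows "qint q (m + n) = q powi n * qint q m + qint q n"
proof (cases "q = 1")
  case False
  then have "1 - q \<noteq> 0" by simp
  then show ?thesis
    using assms False by (simp add: qint_eq power_int_add divide_simps) (simp add: algebra_simps)
qed (simp add: qint_one)

section \<open>Hirzebruch--Jung continued fractions\<close>

fun hj_val :: "int list \<Rightarrow> rat" where
  "hj_val [] = 0"
| "hj_val [c] = of_int c"
| "hj_val (c # d # cs) = of_int c - 1 / hj_val (d # cs)"

definition is_hj :: "rat \<Rightarrow> int list \<Rightarrow> bool" where
  "is_hj x cs \<longleftrightarrow> cs \<noteq> [] \<and> (\<forall>c\<in>set cs. c \<ge> 2) \<and> hj_val cs = x"

definition hj :: "rat \<Rightarrow> int list" where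
  "hj x = (THE cs. is_hj x cs)"

lemma hj_val_gt_1:
  assumes "cs \<noteq> []" "\<forall>c\<in>set cs. c \<ge> 2"
  shows "hj_val cs > 1"
  using assms
proof (induction cs rule: hj_val.induct)
  case (3 c d cs)
  then have "hj_val (d # cs) > 1" by simp
  then have "1 / hj_val (d # cs) < 1" by simp
  moreover have "(of_int c :: rat) \<ge> 2" using 3(3) by simp
  ultimately show ?case by simp
qed auto

lemma hj_val_ceiling:
  assumes "\<forall>c\<in>set (c # cs). c \<ge> 2"
  shows "\<lceil>hj_val (c # cs)\<rceil> = c"
proof (cases cs)
  case (Cons d ds)
  then have "hj_val cs > 1" using assms by (intro hj_val_gt_1) auto
  then have "1 / hj_val cs < 1" "1 / hj_val cs > 0" by simp_all
  then show ?thesis using Cons by (simp add: ceiling_eq_iff)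
qed simp

lemma is_hj_unique:
  assumes "is_hj x cs" "is_hj x ds"
  shows "cs = ds"
  using assms
proof (induction cs arbitrary: x ds)
  case (Cons c cs)
  obtain d ds' where ds: "ds = d # ds'" using Cons.prems(2) by (cases ds) (auto simp: is_hj_def)
  have "\<lceil>x\<rceil> = c" "\<lceil>x\<rceil> = d"
    using Cons.prems hj_val_ceiling ds unfolding is_hj_def by metis+
  then have cd: "c = d" by simp
  have pos: "hj_val es > 1" if "es \<noteq> []" "set es \<subseteq> set cs \<union> set ds'" for es
    using that Cons.prems ds by (intro hj_val_gt_1) (auto simp: is_hj_def)
  show ?case
  proof (cases "cs = [] \<or> ds' = []")
    case True
    have "cs = [] \<and> ds' = []"
    proof (rule ccontr)
      assume "\<not> ?thesis"
      then consider c' cs' where "cs = c' # cs'" "ds' = []" | d' ds'' where "cs = []" "ds' = d' # ds''"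
        using True by (metis neq_Nil_conv)
      then show False
      proof cases
        case 1
        then show False using Cons.prems ds cd pos[of cs] by (auto simp: is_hj_def)
      next
        case 2
        then show False using Cons.prems ds cd pos[of ds'] by (auto simp: is_hj_def)
      qed
    qed
    then show ?thesis using ds cd by simp
  next
    case False
    then obtain c' cs' d' ds'' where *: "cs = c' # cs'" "ds' = d' # ds''" by (metis neq_Nil_conv)
    have "1 / hj_val cs = 1 / hj_val ds'"
      using Cons.prems ds cd * by (auto simp: is_hj_def)
    then have "hj_val cs = hj_val ds'" by simp
    then have "is_hj (hj_val cs) cs" "is_hj (hj_val cs) ds'"
      using Cons.prems ds * by (auto simp: is_hj_def)
    then show ?thesis using Cons.IH ds cd by metis
  qed
qed (simp add: is_hj_def)

lemma is_hj_exists_aux: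
  assumes "d > 0" "of_int p / of_nat d > (1::rat)"
  shows "\<exists>cs. is_hj (of_int p / of_nat d) cs"
  using assms
proof (induction d arbitrary: p rule: less_induct)
  case (less d)
  define x :: rat where "x = of_int p / of_nat d"
  define c where "c = \<lceil>x\<rceil>"
  have x1: "x > 1" using less.prems x_def by simp
  then have c2: "c \<ge> 2" unfolding c_def by (simp add: le_ceiling_iff)
  show ?case
  proof (cases "x = of_int c")
    case True
    then have "is_hj x [c]" using c2 by (simp add: is_hj_def)
    then show ?thesis unfolding x_def by blast
  next
    case False
    define e where "e = c * int d - p"
    have lt: "x < of_int c" "of_int c < x + 1"
      using False unfolding c_def by (simp_all add: ceiling_correct order_less_le, linarith+)
    have ex: "(of_int e :: rat) = (of_int c - x) * of_nat d"
      using less.prems(1) by (simp add: e_def x_def field_simps)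
    have d0: "(of_nat d :: rat) > 0" using less.prems(1) by simp
    have "(of_int e :: rat) > 0" using ex lt d0 by simp
    then have e0: "e > 0" by simp
    have "(of_int e :: rat) < of_nat d" using ex lt d0 by simp
    then have ed: "e < int d" by (metis of_int_less_iff of_int_of_nat_eq)
    define y :: rat where "y = of_int (int d) / of_nat (nat e)"
    have y: "y = 1 / (of_int c - x)" using ex e0 d0 lt by (simp add: y_def field_simps)
    have y1: "y > 1" using lt unfolding y by simp
    have "\<exists>cs. is_hj y cs"
      unfolding y_def using less.IH[of "nat e" "int d"] e0 ed y1 by (simp add: y_def)
    then obtain cs where cs: "is_hj y cs" by blast
    then obtain c' cs' where *: "cs = c' # cs'" by (auto simp: is_hj_def neq_Nil_conv)
    have "is_hj x (c # cs)" using cs c2 lt by (auto simp: is_hj_def * y)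
    then show ?thesis unfolding x_def by blast
  qed
qed

lemma is_hj_exists:
  assumes "x > 1"
  shows "\<exists>cs. is_hj x cs"
proof -
  obtain p d where "quotient_of x = (p, d)" by (cases "quotient_of x")
  then have "d > 0" "x = of_int p / of_nat (nat d)"
    using quotient_of_denom_pos quotient_of_div by fastforce+
  then show ?thesis using is_hj_exists_aux[of "nat d" p] assms by simp
qed

lemma is_hj_hj: "x > 1 \<Longrightarrow> is_hj x (hj x)"
  unfolding hj_def using is_hj_exists is_hj_unique by (metis (no_types, lifting) theI)

lemma hj_eqI: "is_hj x cs \<Longrightarrow> hj x = cs"
  unfolding hj_def using is_hj_unique by blast

section \<open>\<open>q\<close>-rationals\<close>

text \<open>
  The recursion \<open>u\<^sub>j = [c\<^sub>j]\<^sub>q u\<^sub>j\<^sub>-\<^sub>1 - q^(c\<^sub>j\<^sub>-\<^sub>1 - 1) u\<^sub>j\<^sub>-\<^sub>2\<close>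
  with given \<open>u\<^sub>0\<close> and \<open>u\<^sub>1\<close>; the list is 0-indexed, so that \<open>c\<^sub>j\<close> is \<open>cs ! (j - 1)\<close>.
\<close>
fun hj_rec :: "complex \<Rightarrow> int list \<Rightarrow> complex \<Rightarrow> complex \<Rightarrow> nat \<Rightarrow> complex" where
  "hj_rec q cs u0 u1 0 = u0"
| "hj_rec q cs u0 u1 (Suc 0) = u1"
| "hj_rec q cs u0 u1 (Suc (Suc j)) =
     qint q (cs ! Suc j) * hj_rec q cs u0 u1 (Suc j) - q powi (cs ! j - 1) * hj_rec q cs u0 u1 j"

definition R_gt1 :: "rat \<Rightarrow> complex \<Rightarrow> complex" where
  "R_gt1 x q = (let cs = hj x in hj_rec q cs 1 (qint q (cs ! 0)) (length cs))"

definition S_gt1 :: "rat \<Rightarrow> complex \<Rightarrow> complex" where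
  "S_gt1 x q = (let cs = hj x in hj_rec q cs 0 1 (length cs))"

definition shift_int :: "rat \<Rightarrow> int" where
  "shift_int x = (SOME n. x + of_int n > 1)"

definition S_rat :: "rat \<Rightarrow> complex \<Rightarrow> complex" where
  "S_rat x q = S_gt1 (x + of_int (shift_int x)) q"

text \<open>
  The equation \<open>R\<^bsub>x+n\<^esub> = q^n R\<^sub>x + [n]\<^sub>q S\<^sub>x\<close> solved for \<open>R\<^sub>x\<close>.  Lemmas \<open>S_rat_shift\<close> and
  \<open>R_rat_shift\<close> below show that the choice of \<open>n\<close> does not matter.
\<close>
definition R_rat :: "rat \<Rightarrow> complex \<Rightarrow> complex" where
  "R_rat x q = (let n = shift_int x in
     q powi (- n) * (R_gt1 (x + of_int n) q - qint q n * S_rat x q))"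

definition T_rat :: "rat \<Rightarrow> complex \<Rightarrow> complex" where
  "T_rat x q = (1 - q) * R_rat x q - S_rat x q"

lemma hj_rec_incr:
  assumes "q \<noteq> 0" "j > 0"
  shows "hj_rec q ((c + 1) # cs) 0 1 j = hj_rec q (c # cs) 0 1 j"
    and "hj_rec q ((c + 1) # cs) 1 (qint q (c + 1)) j
         = q * hj_rec q (c # cs) 1 (qint q c) j + hj_rec q (c # cs) 0 1 j"
proof -
  have c1: "qint q (c + 1) = q * qint q c + 1"
    using qint_add[OF assms(1), of c 1] qint_nat_Suc[of q 0] by (simp add: qint_def[of q 0])
  have c2: "q powi c = q * q powi (c - 1)"
    using power_int_add[of q 1 "c - 1"] assms(1) by simp
  let ?P = "\<lambda>j. hj_rec q ((c + 1) # cs) 0 1 j = hj_rec q (c # cs) 0 1 j \<and>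
       hj_rec q ((c + 1) # cs) 1 (qint q (c + 1)) j
         = q * hj_rec q (c # cs) 1 (qint q c) j + hj_rec q (c # cs) 0 1 j"
  have "?P (Suc i)" for i
  proof (induction i rule: less_induct)
    case (less i)
    consider "i = 0" | "i = 1" | k where "i = Suc (Suc k)"
      by (metis One_nat_def not0_implies_Suc)
    then show ?case
    proof cases
      case 3
      then have "k < i" "Suc k < i" by simp_all
      note IH = less.IH[OF this(1)] less.IH[OF this(2)]
      have rec: "hj_rec q (d # cs) u v (Suc (Suc (Suc k))) =
          qint q (cs ! Suc k) * hj_rec q (d # cs) u v (Suc (Suc k)) -
          q powi (cs ! k - 1) * hj_rec q (d # cs) u v (Suc k)" for d u v
        using hj_rec.simps(3)[of q "d # cs" u v "Suc k"] by (simp del: hj_rec.simps)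
      show ?thesis unfolding 3 rec using IH by (simp only: simp_thms) (simp only: algebra_simps)
    qed (simp_all add: c1 c1[unfolded add.commute[of c]] c2 algebra_simps)
  qed
  then have "?P j" using assms(2) by (cases j) auto
  then show "hj_rec q ((c + 1) # cs) 0 1 j = hj_rec q (c # cs) 0 1 j"
    and "hj_rec q ((c + 1) # cs) 1 (qint q (c + 1)) j
         = q * hj_rec q (c # cs) 1 (qint q c) j + hj_rec q (c # cs) 0 1 j" by auto
qed

lemma gt1_Suc:
  assumes "q \<noteq> 0" "x > 1"
  shows "S_gt1 (x + 1) q = S_gt1 x q"
    and "R_gt1 (x + 1) q = q * R_gt1 x q + S_gt1 x q"
proof -
  obtain c cs where h: "hj x = c # cs" "is_hj x (c # cs)"
    using is_hj_hj[OF assms(2)] by (cases "hj x") (auto simp: is_hj_def)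
  then have "is_hj (x + 1) ((c + 1) # cs)" by (cases cs) (auto simp: is_hj_def)
  then have h': "hj (x + 1) = (c + 1) # cs" by (rule hj_eqI)
  show "S_gt1 (x + 1) q = S_gt1 x q"
    and "R_gt1 (x + 1) q = q * R_gt1 x q + S_gt1 x q"
    using hj_rec_incr[OF assms(1), of "length (c # cs)" c cs]
    unfolding R_gt1_def S_gt1_def h(1) h' Let_def by simp_all
qed

lemma gt1_add_nat:
  assumes "q \<noteq> 0" "x > 1"
  shows "S_gt1 (x + of_nat k) q = S_gt1 x q \<and>
         R_gt1 (x + of_nat k) q = q ^ k * R_gt1 x q + qint q (int k) * S_gt1 x q"
proof (induction k)
  case (Suc k)
  have "x + of_nat k > 1" using assms(2) by (simp add: add_strict_increasing)
  from gt1_Suc[OF assms(1) this]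
  have "S_gt1 (x + of_nat (Suc k)) q = S_gt1 (x + of_nat k) q"
    "R_gt1 (x + of_nat (Suc k)) q = q * R_gt1 (x + of_nat k) q + S_gt1 (x + of_nat k) q"
    by (simp_all add: add_ac)
  moreover have "qint q (int (Suc k)) = q * qint q (int k) + 1"
    using qint_add[OF assms(1), of "int k" 1] qint_nat_Suc[of q 0]
    by (simp add: qint_def[of q 0] add_ac)
  ultimately show ?case using Suc by (simp add: algebra_simps del: of_nat_Suc)
qed (simp add: qint_def)

lemma shift_int: "x + of_int (shift_int x) > 1"
proof -
  have "x + of_int (2 - \<lfloor>x\<rfloor>) > 1" by (simp, linarith)
  then show ?thesis unfolding shift_int_def by (rule someI)
qed

lemma gt1_independent:
  assumes "q \<noteq> 0" "x + of_int m > 1" "m \<le> n"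
  shows "S_gt1 (x + of_int n) q = S_gt1 (x + of_int m) q"
    and "q powi (- n) * (R_gt1 (x + of_int n) q - qint q n * S_gt1 (x + of_int n) q)
       = q powi (- m) * (R_gt1 (x + of_int m) q - qint q m * S_gt1 (x + of_int m) q)"
proof -
  define k where "k = nat (n - m)"
  have n: "n = m + int k" using assms(3) by (simp add: k_def)
  have *: "x + of_int n = x + of_int m + of_nat k" by (simp add: n)
  have qn: "qint q n = q ^ k * qint q m + qint q (int k)"
    using qint_add[OF assms(1), of m "int k"] by (simp add: n)
  have qp: "q powi (- n) * q ^ k = q powi (- m)"
    using power_int_add[of q "- n" "int k"] assms(1) by (simp add: n)
  note g = gt1_add_nat[OF assms(1,2), of k, folded *]
  show S: "S_gt1 (x + of_int n) q = S_gt1 (x + of_int m) q" using g by blast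
  show "q powi (- n) * (R_gt1 (x + of_int n) q - qint q n * S_gt1 (x + of_int n) q)
      = q powi (- m) * (R_gt1 (x + of_int m) q - qint q m * S_gt1 (x + of_int m) q)"
    unfolding qp[symmetric] using g qn by (simp add: algebra_simps)
qed

lemma
  assumes "q \<noteq> 0" "x + of_int n > 1"
  shows S_rat_shift: "S_gt1 (x + of_int n) q = S_rat x q"
    and R_rat_shift: "R_gt1 (x + of_int n) q = q powi n * R_rat x q + qint q n * S_rat x q"
proof -
  define m where "m = shift_int x"
  have m: "x + of_int m > 1" unfolding m_def by (rule shift_int)
  have *: "S_gt1 (x + of_int n) q = S_gt1 (x + of_int m) q \<and>
    q powi (- n) * (R_gt1 (x + of_int n) q - qint q n * S_gt1 (x + of_int n) q)
    = q powi (- m) * (R_gt1 (x + of_int m) q - qint q m * S_gt1 (x + of_int m) q)"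
    using gt1_independent[OF assms(1) m, of n] gt1_independent[OF assms, of m] by (metis linear)
  then show S: "S_gt1 (x + of_int n) q = S_rat x q" by (simp add: S_rat_def m_def)
  have "R_rat x q = q powi (- n) * (R_gt1 (x + of_int n) q - qint q n * S_rat x q)"
    using * S by (simp add: R_rat_def Let_def m_def[symmetric] S_rat_def)
  moreover have "q powi n * q powi (- n) = 1"
    using power_int_add[of q n "- n"] assms(1) by simp
  ultimately show "R_gt1 (x + of_int n) q = q powi n * R_rat x q + qint q n * S_rat x q"
    by (simp add: mult.assoc[symmetric])
qed

lemma hj_rec_det:
  assumes "q \<noteq> 0"
  shows "hj_rec q cs 1 v (Suc j) * hj_rec q cs 0 1 j - hj_rec q cs 1 v j * hj_rec q cs 0 1 (Suc j) \<noteq> 0"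
proof (induction j)
  case (Suc j)
  have "hj_rec q cs 1 v (Suc (Suc j)) * hj_rec q cs 0 1 (Suc j)
      - hj_rec q cs 1 v (Suc j) * hj_rec q cs 0 1 (Suc (Suc j))
      = q powi (cs ! j - 1) *
        (hj_rec q cs 1 v (Suc j) * hj_rec q cs 0 1 j - hj_rec q cs 1 v j * hj_rec q cs 0 1 (Suc j))"
    by (simp add: algebra_simps)
  then show ?case using Suc assms by simp
qed simp

lemma R_S_nonzero:
  assumes "q \<noteq> 0"
  shows "(R_rat x q, S_rat x q) \<noteq> (0, 0)"
proof
  assume *: "(R_rat x q, S_rat x q) = (0, 0)"
  define y where "y = x + of_int (shift_int x)"
  have y: "y > 1" unfolding y_def by (rule shift_int)
  have "R_gt1 y q = 0" "S_gt1 y q = 0"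
    using * S_rat_shift[OF assms shift_int] R_rat_shift[OF assms shift_int] by (simp_all add: y_def)
  moreover obtain j where "length (hj y) = Suc j"
    using is_hj_hj[OF y] by (cases "hj y") (auto simp: is_hj_def)
  ultimately show False
    using hj_rec_det[OF assms, of "hj y" "qint q (hj y ! 0)" j]
    by (simp add: R_gt1_def S_gt1_def Let_def)
qed

section \<open>The complex projective line\<close>

text \<open>Nonzero vectors of \<open>\<complex>\<^sup>2\<close> up to scaling, with the quotient topology.\<close>

definition proj_rel :: "complex \<times> complex \<Rightarrow> complex \<times> complex \<Rightarrow> bool" where
  "proj_rel u v \<longleftrightarrow> u \<noteq> (0, 0) \<and> v \<noteq> (0, 0) \<and>
     (\<exists>c. c \<noteq> 0 \<and> fst v = c * fst u \<and> snd v = c * snd u)"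

lemma part_equivp_proj_rel: "part_equivp proj_rel"
proof (rule part_equivpI)
  show "\<exists>u. proj_rel u u" unfolding proj_rel_def by (intro exI[of _ "(1, 1)"]) (auto intro: exI[of _ 1])
  show "symp proj_rel"
  proof (rule sympI)
    fix u v assume "proj_rel u v"
    then obtain c where "u \<noteq> (0, 0)" "v \<noteq> (0, 0)" "c \<noteq> 0" "fst v = c * fst u" "snd v = c * snd u"
      unfolding proj_rel_def by blast
    then show "proj_rel v u" unfolding proj_rel_def by (auto intro!: exI[of _ "inverse c"])
  qed
  show "transp proj_rel"
  proof (rule transpI)
    fix u v w assume "proj_rel u v" "proj_rel v w"
    then obtain c d where "u \<noteq> (0, 0)" "w \<noteq> (0, 0)" "c \<noteq> 0" "d \<noteq> 0"
      "fst v = c * fst u" "snd v = c * snd u" "fst w = d * fst v" "snd w = d * snd v"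
      unfolding proj_rel_def by blast
    then show "proj_rel u w" unfolding proj_rel_def by (auto intro!: exI[of _ "d * c"])
  qed
qed

quotient_type cp1 = "complex \<times> complex" / partial: proj_rel
  by (rule part_equivp_proj_rel)

text \<open>The point \<open>[a : b]\<close>, meaningful for \<open>(a, b) \<noteq> (0, 0)\<close>.\<close>
definition proj_point :: "complex \<Rightarrow> complex \<Rightarrow> cp1" where
  "proj_point a b = abs_cp1 (a, b)"

lemma proj_point_eq_iff:
  assumes "(a, b) \<noteq> (0, 0)" "(c, d) \<noteq> (0, 0)"
  shows "proj_point a b = proj_point c d \<longleftrightarrow> a * d = b * c"
proof -
  have "proj_rel u u" if "u \<noteq> (0, 0)" for u
    using that unfolding proj_rel_def by (auto intro!: exI[of _ 1])
  then have "proj_point a b = proj_point c d \<longleftrightarrow> proj_rel (a, b) (c, d)"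
    unfolding proj_point_def using assms Quotient_rel[OF Quotient_cp1] by blast
  also have "\<dots> \<longleftrightarrow> a * d = b * c"
  proof
    assume eq: "a * d = b * c"
    show "proj_rel (a, b) (c, d)"
    proof (cases "a = 0")
      case True
      then have "b \<noteq> 0" "c = 0" "d \<noteq> 0" using eq assms by auto
      then show ?thesis using True by (auto simp: proj_rel_def intro!: exI[of _ "d / b"])
    next
      case False
      then have "c \<noteq> 0" using eq assms by auto
      then show ?thesis using False eq assms
        by (auto simp: proj_rel_def field_simps intro!: exI[of _ "c / a"])
    qed
  qed (auto simp: proj_rel_def)
  finally show ?thesis .
qed

lemma proj_point_exhaust: obtains a b where "(a, b) \<noteq> (0, 0)" "z = proj_point a b"
proof -
  have "proj_rel (rep_cp1 z) (rep_cp1 z)" "abs_cp1 (rep_cp1 z) = z"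
    using Quotient_cp1 by (simp_all add: Quotient_rep_reflp Quotient_abs_rep)
  then show ?thesis using that[of "fst (rep_cp1 z)" "snd (rep_cp1 z)"]
    by (auto simp: proj_point_def proj_rel_def)
qed

instantiation cp1 :: topological_space
begin

definition open_cp1 :: "cp1 set \<Rightarrow> bool" where
  "open_cp1 U \<longleftrightarrow> open {(a, b). (a, b) \<noteq> (0, 0) \<and> proj_point a b \<in> U}"

instance
proof
  have *: "{(a, b). (a, b) \<noteq> (0, 0) \<and> proj_point a b \<in> UNIV} = - {(0, 0)}" by auto
  show "open (UNIV :: cp1 set)" unfolding open_cp1_def * by (intro open_Compl closed_singleton)
next
  fix S T :: "cp1 set" assume "open S" "open T"
  moreover have "{(a, b). (a, b) \<noteq> (0, 0) \<and> proj_point a b \<in> S \<inter> T} =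
    {(a, b). (a, b) \<noteq> (0, 0) \<and> proj_point a b \<in> S} \<inter>
    {(a, b). (a, b) \<noteq> (0, 0) \<and> proj_point a b \<in> T}" by auto
  ultimately show "open (S \<inter> T)" unfolding open_cp1_def by (simp only: open_Int)
next
  fix K :: "cp1 set set" assume "\<forall>S\<in>K. open S"
  moreover have "{(a, b). (a, b) \<noteq> (0, 0) \<and> proj_point a b \<in> \<Union>K} =
    (\<Union>S\<in>K. {(a, b). (a, b) \<noteq> (0, 0) \<and> proj_point a b \<in> S})" by auto
  ultimately show "open (\<Union>K)" unfolding open_cp1_def by (simp only: open_UN)
qed

end

definition cp1_of :: "complex \<Rightarrow> cp1" where
  "cp1_of z = proj_point z 1"

definition cp1_infinity :: cp1 where
  "cp1_infinity = proj_point 1 0"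

definition q_rat :: "rat \<Rightarrow> complex \<Rightarrow> cp1" where
  "q_rat x q = proj_point (R_rat x q) (S_rat x q)"

lemma q_rat_eq:
  assumes "q \<noteq> 0"
  shows "q_rat x q = (if S_rat x q = 0 then cp1_infinity else cp1_of (R_rat x q / S_rat x q))"
  using R_S_nonzero[OF assms, of x] unfolding q_rat_def cp1_infinity_def cp1_of_def
  by (auto simp: proj_point_eq_iff)

definition X_set :: "complex \<Rightarrow> cp1 set" where
  "X_set q = (\<lambda>y. q_rat y q) ` UNIV"

end

theory Submission
  imports Defs "HOL-Analysis.Kronecker_Approximation_Theorem"
begin

text \<open>
  Everything follows from one invariant. In the coordinates \<open>T = (1 - q) R - S\<close> and \<open>S\<close> the translation
  \<open>x \<mapsto> x + 1\<close> acts diagonally as \<open>(T, S) \<mapsto> (q T, S)\<close>, and the inversion \<open>x \<mapsto> c - 1 / x\<close> also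
  preserves the Hermitian form \<open>|T|\<^sup>2 + k |S|\<^sup>2\<close> with \<open>k = 1 - 2 Re q = |1 - q|\<^sup>2 - 1\<close>. Hence
  \<open>|T\<^sub>x|\<^sup>2 + k |S\<^sub>x|\<^sup>2 = |1 - q|\<^sup>2\<close> for every rational \<open>x\<close> (lemma \<open>T_S_invariant\<close>). On \<open>C_minus\<close> the form
  is positive semidefinite and the upper bound is the Cauchy-Schwarz inequality; at the endpoints
  \<open>k = 0\<close> and \<open>|T| = |1 - q| = 1\<close>; on \<open>C_plus\<close> the form is indefinite and the lower bound is its
  positivity on the vectors of rationals.

  For the closure, suppose that \<open>q\<close> is not a root of unity. The powers of \<open>q\<close> are dense in the circle,
  so translations rotate the phase of \<open>T\<close> arbitrarily, up to approximation, and the invariant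
  determines \<open>|T|\<close> from \<open>|S|\<close>. It therefore suffices that the moduli \<open>|S\<^sub>x|\<close> are dense among the
  values \<open>r \<ge> 0\<close> with \<open>k r\<^sup>2 \<le> |1 - q|\<^sup>2\<close> (lemma \<open>S_moduli_full\<close>). A rotation followed by an inversion
  turns \<open>(T, S)\<close> into a vector whose second entry has modulus \<open>|u T + S| / |1 - q|\<close> with \<open>|u| = 1\<close>
  at will; so from the modulus \<open>r\<close> one reaches the whole interval between \<open>||T| - r| / |1 - q|\<close> and
  \<open>(|T| + r) / |1 - q|\<close>. Starting from \<open>r = 1\<close> this covers \<open>[0, 1]\<close>. The upper end exceeds
  \<open>r\<close> for every \<open>r \<ge> 0\<close> if \<open>k < 0\<close>, and for every \<open>r < 1 / sqrt k\<close> if \<open>k > 0\<close>; a supremum argument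
  (lemma \<open>interval_exhausted_by_expansion\<close>) gives all these moduli, and for \<open>k > 0\<close> one more step
  from \<open>[0, 1 / sqrt k]\<close> covers the remaining ones. The case \<open>k = 0\<close> does not occur because
  \<open>Re q = 1 / 2\<close> makes \<open>q\<close> a sixth root of unity. Every point with positive form is then a
  limit of \<open>q\<close>-rationals, and the points where the form vanishes are limits of such points.
\<close>

section \<open>The modular action on the vectors \<open>(T, S)\<close>\<close>

lemma one_minus_mult_qint:
  assumes "q \<noteq> 0"
  shows "(1 - q) * qint q n = 1 - q powi n"
  using assms by (cases "q = 1") (simp_all add: qint_eq)

lemma S_rat_gt_1:
  assumes "q \<noteq> 0" "x > 1"
  shows "S_rat x q = S_gt1 x q"
  using S_rat_shift[of q x 0] assms by simp

lemma R_rat_gt_1: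
  assumes "q \<noteq> 0" "x > 1"
  shows "R_rat x q = R_gt1 x q"
  using R_rat_shift[of q x 0] assms by (simp add: qint_def)

lemma S_rat_add_nat:
  assumes "q \<noteq> 0"
  shows "S_rat (x + of_nat n) q = S_rat x q"
proof -
  define m where "m = shift_int (x + of_nat n)"
  have m: "(x + of_nat n) + of_int m > 1"
    unfolding m_def by (rule shift_int)
  have eq: "(x + of_nat n) + of_int m = x + of_int (int n + m)"
    by simp
  show ?thesis
    using S_rat_shift[OF assms m] S_rat_shift[OF assms m[unfolded eq]] unfolding eq by simp
qed

lemma R_rat_add_nat:
  assumes "q \<noteq> 0"
  shows "R_rat (x + of_nat n) q = q ^ n * R_rat x q + qint q (int n) * S_rat x q"
proof -
  define m where "m = shift_int (x + of_nat n)"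
  have m: "(x + of_nat n) + of_int m > 1"
    unfolding m_def by (rule shift_int)
  have eq: "(x + of_nat n) + of_int m = x + of_int (int n + m)"
    by simp
  have "q powi m * R_rat (x + of_nat n) q + qint q m * S_rat x q
      = q powi (int n + m) * R_rat x q + qint q (int n + m) * S_rat x q"
    using R_rat_shift[OF assms m] R_rat_shift[OF assms m[unfolded eq]] S_rat_add_nat[OF assms]
    unfolding eq by simp
  also have "\<dots> = q powi m * (q ^ n * R_rat x q + qint q (int n) * S_rat x q) + qint q m * S_rat x q"
    unfolding qint_add[OF assms] using assms by (simp add: power_int_add algebra_simps)
  finally show ?thesis
    using assms by simp
qed

text \<open>
  The form \<open>T\<close> is the eigenvector of the translation that is independent of \<open>S\<close>; this is what makes
  the pair \<open>(T, S)\<close> a better coordinate than \<open>(R, S)\<close>.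
\<close>
lemma T_rat_add_nat:
  assumes "q \<noteq> 0"
  shows "T_rat (x + of_nat n) q = q ^ n * T_rat x q"
proof -
  have "T_rat (x + of_nat n) q
      = q ^ n * (1 - q) * R_rat x q + ((1 - q) * qint q (int n)) * S_rat x q - S_rat x q"
    unfolding T_rat_def S_rat_add_nat[OF assms] R_rat_add_nat[OF assms] by (simp add: algebra_simps)
  also have "\<dots> = q ^ n * T_rat x q"
    unfolding one_minus_mult_qint[OF assms] by (simp add: T_rat_def algebra_simps)
  finally show ?thesis .
qed

text \<open>
  The recursion in the definition of the continuants expands at the last entry of the list. Expansion
  at the first entry rests on dropping that entry and starting one step later.
\<close>
lemma hj_rec_Cons:
  assumes "cs \<noteq> []"
  shows "hj_rec q (c # cs) u v (Suc j)
    = hj_rec q cs v (qint q (cs ! 0) * v - q powi (c - 1) * u) j"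
proof (induction j rule: less_induct)
  case (less j)
  consider "j = 0" | "j = 1" | i where "j = Suc (Suc i)"
    by (metis One_nat_def not0_implies_Suc)
  then show ?case
  proof cases
    case 3
    then have "i < j" "Suc i < j" by simp_all
    note IH = less.IH[OF this(1)] less.IH[OF this(2)]
    have "hj_rec q (c # cs) u v (Suc (Suc (Suc i)))
        = qint q (cs ! Suc i) * hj_rec q (c # cs) u v (Suc (Suc i))
          - q powi (cs ! i - 1) * hj_rec q (c # cs) u v (Suc i)"
      using hj_rec.simps(3)[of q "c # cs" u v "Suc i"] by (simp del: hj_rec.simps)
    then show ?thesis
      unfolding 3 IH by simp
  qed simp_all
qed

lemma hj_rec_linear:
  "hj_rec q cs (a * u - b * u') (a * v - b * v') j = a * hj_rec q cs u v j - b * hj_rec q cs u' v' j"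
proof (induction q cs u v j rule: hj_rec.induct)
  case (3 q cs u v j)
  show ?case
    by (simp only: hj_rec.simps 3) (simp add: algebra_simps)
qed simp_all

lemma is_hj_Cons:
  assumes "is_hj x cs" "c \<ge> 2"
  shows "is_hj (of_int c - 1 / x) (c # cs)"
  using assms by (cases cs) (auto simp: is_hj_def)

lemma
  assumes "q \<noteq> 0" "x > 1" "c \<ge> 2"
  shows S_rat_inversion: "S_rat (of_int c - 1 / x) q = R_rat x q"
    and R_rat_inversion:
      "R_rat (of_int c - 1 / x) q = qint q c * R_rat x q - q powi (c - 1) * S_rat x q"
proof -
  define cs where "cs = hj x"
  have cs: "is_hj x cs" "cs \<noteq> []"
    using is_hj_hj[OF assms(2)] by (auto simp: cs_def is_hj_def)
  define y where "y = of_int c - 1 / x"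
  have hj_y: "hj y = c # cs"
    unfolding y_def using is_hj_Cons[OF cs(1) assms(3)] by (rule hj_eqI)
  have "1 / x < 1"
    using assms(2) by simp
  moreover have "(of_int c :: rat) \<ge> 2"
    using assms(3) by simp
  ultimately have y: "y > 1"
    unfolding y_def by linarith
  have "S_gt1 y q = R_gt1 x q"
    unfolding S_gt1_def R_gt1_def hj_y Let_def cs_def[symmetric]
    using hj_rec_Cons[OF cs(2), of q c 0 1 "length cs"] by simp
  then show "S_rat (of_int c - 1 / x) q = R_rat x q"
    using assms y by (simp add: S_rat_gt_1 R_rat_gt_1 y_def)
  have "R_gt1 y q = hj_rec q cs (qint q c * 1 - q powi (c - 1) * 0)
      (qint q c * qint q (cs ! 0) - q powi (c - 1) * 1) (length cs)"
    unfolding R_gt1_def hj_y Let_def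
    using hj_rec_Cons[OF cs(2), of q c 1 "qint q c" "length cs"] by (simp add: mult.commute)
  also have "\<dots> = qint q c * R_gt1 x q - q powi (c - 1) * S_gt1 x q"
    unfolding hj_rec_linear R_gt1_def S_gt1_def cs_def[symmetric] Let_def ..
  finally show "R_rat (of_int c - 1 / x) q = qint q c * R_rat x q - q powi (c - 1) * S_rat x q"
    using assms y by (simp add: S_rat_gt_1 R_rat_gt_1 y_def)
qed

section \<open>The invariant Hermitian form\<close>

lemma cmod_one_minus_unit_squared:
  assumes "cmod q = 1"
  shows "(cmod (1 - q))\<^sup>2 = 2 - 2 * Re q"
  using assms cmod_power2[of q] cmod_power2[of "1 - q"] by (simp add: power2_eq_square algebra_simps)

text \<open>
  Up to a unit, \<open>x \<mapsto> c - 1 / x\<close> replaces \<open>(T, S) = ((1 - q) R - S, S)\<close> by \<open>(q R + (1 - q) S, R)\<close>.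
  Both sides below expand to \<open>(2 - 2 Re q) (|R|\<^sup>2 + |S|\<^sup>2) - 2 Re ((1 - q) R S\<^sup>*)\<close>; the cross terms
  agree because \<open>q (1 - q\<^sup>*) = q - 1\<close> on the unit circle.
\<close>
lemma hermitian_form_inversion:
  fixes q R S :: complex
  assumes "cmod q = 1"
  shows "(cmod (q * R + (1 - q) * S))\<^sup>2 + (1 - 2 * Re q) * (cmod R)\<^sup>2
    = (cmod ((1 - q) * R - S))\<^sup>2 + (1 - 2 * Re q) * (cmod S)\<^sup>2"
proof -
  have q: "Re q * Re q + Im q * Im q = 1"
    using assms cmod_power2[of q] by (simp add: power2_eq_square)
  show ?thesis
    unfolding cmod_power2 unfolding power2_eq_square by simp (use q in algebra)
qed

text \<open>
  The vector of an integer is \<open>(T, S) = (- q^c, 1)\<close>, where the form takes the value \<open>2 - 2 Re q\<close>;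
  translations and inversions preserve that value.
\<close>
lemma T_S_invariant:
  assumes "cmod q = 1"
  shows "(cmod (T_rat x q))\<^sup>2 + (1 - 2 * Re q) * (cmod (S_rat x q))\<^sup>2 = (cmod (1 - q))\<^sup>2"
proof -
  have q0: "q \<noteq> 0"
    using assms by auto
  have gt_1: "(cmod (T_rat x q))\<^sup>2 + (1 - 2 * Re q) * (cmod (S_rat x q))\<^sup>2 = 2 - 2 * Re q"
    if "is_hj x cs" for x cs
    using that
  proof (induction cs arbitrary: x)
    case Nil
    then show ?case by (simp add: is_hj_def)
  next
    case (Cons c cs)
    show ?case
    proof (cases "cs = []")
      case True
      then have hj: "hj x = [c]" and x: "x > 1"
        using Cons.prems hj_eqI[OF Cons.prems] hj_val_gt_1[of "[c]"] by (auto simp: is_hj_def)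
      have S: "S_rat x q = 1" and R: "R_rat x q = qint q c"
        using x q0 hj by (simp_all add: S_rat_gt_1 R_rat_gt_1 S_gt1_def R_gt1_def Let_def)
      have "T_rat x q = - (q powi c)"
        unfolding T_rat_def S R using one_minus_mult_qint[OF q0] by simp
      then show ?thesis
        unfolding S using assms by (simp add: norm_power_int)
    next
      case False
      define y where "y = hj_val cs"
      have y: "is_hj y cs" "y > 1" and c: "c \<ge> 2"
        using Cons.prems False hj_val_gt_1[of cs] by (auto simp: is_hj_def y_def)
      have "is_hj (of_int c - 1 / y) (c # cs)"
        using is_hj_Cons[OF y(1) c] .
      then have x: "x = of_int c - 1 / y"
        using Cons.prems by (simp add: is_hj_def)
      have qc: "q powi c = q powi (c - 1) * q"
        using power_int_add[of q "c - 1" 1] q0 by simp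
      have "T_rat x q = ((1 - q) * qint q c) * R_rat y q
          - (1 - q) * q powi (c - 1) * S_rat y q - R_rat y q"
        unfolding T_rat_def x S_rat_inversion[OF q0 y(2) c] R_rat_inversion[OF q0 y(2) c]
        by (simp add: algebra_simps)
      also have "\<dots> = - (q powi (c - 1)) * (q * R_rat y q + (1 - q) * S_rat y q)"
        unfolding one_minus_mult_qint[OF q0] qc by (simp add: algebra_simps)
      finally have "cmod (T_rat x q) = cmod (q * R_rat y q + (1 - q) * S_rat y q)"
        using assms by (simp add: norm_mult norm_power_int)
      then show ?thesis
        using Cons.IH[OF y(1)] hermitian_form_inversion[OF assms, of "R_rat y q" "S_rat y q"]
        unfolding x S_rat_inversion[OF q0 y(2) c] by (simp add: T_rat_def)
    qed
  qed
  obtain n :: nat where "1 - x < of_nat n"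
    using ex_less_of_nat_mult[of 1 "1 - x"] by auto
  then have "x + of_nat n > 1"
    by linarith
  from gt_1[OF is_hj_hj[OF this]] show ?thesis
    using assms q0
    by (simp add: T_rat_add_nat S_rat_add_nat norm_mult norm_power cmod_one_minus_unit_squared)
qed

section \<open>The inequalities\<close>

lemma inverse_unit: "cmod q = 1 \<Longrightarrow> inverse q = cnj q"
  using complex_norm_square[of q] by (simp add: inverse_unique)

text \<open>
  By Cauchy-Schwarz, \<open>|T| + k |S| \<le> sqrt (1 + k) sqrt (|T|\<^sup>2 + k |S|\<^sup>2)\<close> for \<open>k \<ge> 0\<close>. With
  \<open>k = 1 - 2 Re q\<close> both factors equal \<open>|1 - q|\<close>, and \<open>|1 - q| \<ge> 1\<close> on \<open>C_minus\<close>.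
\<close>
lemma T_S_upper_bound:
  assumes "q \<in> C_minus"
  shows "cmod (T_rat x q) + (1 - 2 * Re q) * cmod (S_rat x q) \<le> cmod (1 - q) ^ 3"
proof -
  have q: "cmod q = 1" "Re q \<le> 1 / 2"
    using assms by (simp_all add: C_minus_def)
  define k where "k = 1 - 2 * Re q"
  define t where "t = cmod (T_rat x q)"
  define s where "s = cmod (S_rat x q)"
  define p where "p = cmod (1 - q)"
  have k: "k \<ge> 0" and p2: "p\<^sup>2 = 1 + k"
    using q by (simp_all add: k_def p_def cmod_one_minus_unit_squared)
  have inv: "t\<^sup>2 + k * s\<^sup>2 = 1 + k"
    using T_S_invariant[OF q(1), of x] p2 by (simp add: k_def t_def s_def p_def)
  have "(1 + k) * (t\<^sup>2 + k * s\<^sup>2) - (t + k * s)\<^sup>2 = k * (t - s)\<^sup>2"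
    by (simp add: power2_eq_square algebra_simps)
  then have "(t + k * s)\<^sup>2 \<le> (1 + k) * (1 + k)"
    using k inv by (metis diff_ge_0_iff_ge mult_nonneg_nonneg zero_le_power2)
  then have le: "t + k * s \<le> p\<^sup>2"
    using k p2 power2_le_imp_le[of "t + k * s" "1 + k"] by (simp add: power2_eq_square)
  have "p \<ge> 1"
    using k p2 power2_le_imp_le[of 1 p] by (simp add: p_def)
  then have "p\<^sup>2 \<le> p ^ 3"
    by (intro power_increasing) auto
  then show ?thesis
    using le by (simp add: t_def s_def k_def p_def)
qed

lemma T_S_lower_bound:
  assumes "q \<in> C_plus"
  shows "sqrt (2 * Re q - 1) * cmod (S_rat x q) \<le> cmod (T_rat x q)"
proof (rule power2_le_imp_le)
  have q: "cmod q = 1" "Re q > 1 / 2"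
    using assms by (simp_all add: C_plus_def)
  have "(2 * Re q - 1) * (cmod (S_rat x q))\<^sup>2 = (cmod (T_rat x q))\<^sup>2 - (cmod (1 - q))\<^sup>2"
    using T_S_invariant[OF q(1), of x] by (simp add: algebra_simps)
  also have "\<dots> \<le> (cmod (T_rat x q))\<^sup>2"
    by simp
  finally show "(sqrt (2 * Re q - 1) * cmod (S_rat x q))\<^sup>2 \<le> (cmod (T_rat x q))\<^sup>2"
    using q(2) by (simp add: power_mult_distrib)
qed simp

section \<open>Density of the moduli \<open>|S|\<close>\<close>

text \<open>
  The multiples of an irrational number are dense modulo 1 (Kronecker); the map
  \<open>t \<mapsto> exp (2 \<pi> i t)\<close> carries this over to the circle.
\<close>
lemma powers_dense_in_circle:
  fixes q u :: complex
  assumes "cmod q = 1" "\<not> root_of_unity q" "cmod u = 1"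
  shows "u \<in> closure (range (\<lambda>n. q ^ n))"
proof -
  define \<theta> where "\<theta> = Arg q / (2 * pi)"
  define \<alpha> where "\<alpha> = frac (Arg u / (2 * pi))"
  define f where "f = (\<lambda>t. cis (2 * pi * t))"
  have f_frac: "f (frac t) = f t" for t
  proof -
    have "f t = cis (2 * pi * frac t + 2 * pi * of_int \<lfloor>t\<rfloor>)"
      by (simp add: f_def frac_def algebra_simps)
    also have "\<dots> = f (frac t) * cis (2 * pi * of_int \<lfloor>t\<rfloor>)"
      by (simp only: f_def cis_mult)
    finally show ?thesis
      by (simp add: cis_multiple_2pi)
  qed
  have q: "q = f \<theta>"
    using assms(1) cis_Arg[of q] by (cases "q = 0") (simp_all add: f_def \<theta>_def sgn_eq)
  have u: "u = f \<alpha>"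
    using assms(3) cis_Arg[of u] unfolding \<alpha>_def f_frac by (cases "u = 0") (simp_all add: f_def sgn_eq)
  have q_pow: "q ^ n = f (frac (real n * \<theta>))" for n
    unfolding f_frac q by (simp add: f_def Complex.DeMoivre mult_ac)
  have "\<theta> \<notin> \<rat>"
  proof
    assume "\<theta> \<in> \<rat>"
    then obtain a b where "b > 0" "\<theta> = of_int a / of_int b"
      by (meson Rats_cases')
    then have "real (nat b) * \<theta> = of_int a"
      by simp
    then have "q ^ nat b = f (of_int a)"
      unfolding q_pow f_frac by simp
    also have "\<dots> = 1"
      by (simp add: f_def cis_multiple_2pi)
    finally show False
      using assms(2) \<open>b > 0\<close> unfolding root_of_unity_def by (metis zero_less_nat_eq)
  qed
  then have "\<alpha> \<in> closure (range (\<lambda>n. frac (real n * \<theta>)))"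
    by (simp add: Kronecker_approx_1 \<alpha>_def frac_lt_1 less_imp_le)
  moreover have "f ` closure (range (\<lambda>n. frac (real n * \<theta>))) \<subseteq> closure (range (\<lambda>n. q ^ n))"
  proof (rule image_closure_subset)
    show "continuous_on (closure (range (\<lambda>n. frac (real n * \<theta>)))) f"
      unfolding f_def cis_conv_exp by (intro continuous_intros)
    show "f ` range (\<lambda>n. frac (real n * \<theta>)) \<subseteq> closure (range (\<lambda>n. q ^ n))"
      using closure_subset by (fastforce simp: q_pow)
  qed simp
  ultimately show ?thesis
    using u by blast
qed

lemma exists_unit_aligned:
  fixes z b :: complex
  obtains u where "cmod u = 1" "cmod (u * z - b) = \<bar>cmod z - cmod b\<bar>"
proof -
  define d where "d = (if b = 0 then 1 else sgn b)"
  define u where "u = (if z = 0 then 1 else d / sgn z)"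
  have d: "cmod d = 1" "b = of_real (cmod b) * d"
    by (auto simp: d_def sgn_eq norm_divide)
  have u: "cmod u = 1" "u * z = of_real (cmod z) * d"
    using d(1) by (auto simp: u_def norm_divide norm_mult sgn_eq)
  have "u * z - b = of_real (cmod z - cmod b) * d"
    unfolding u(2) by (subst d(2)) (simp add: algebra_simps)
  then have "cmod (u * z - b) = \<bar>cmod z - cmod b\<bar>"
    using d(1) by (simp only: norm_mult norm_of_real mult_1_right)
  with u show ?thesis
    using that by blast
qed

text \<open>
  As \<open>u\<close> runs through the unit circle, \<open>|u z + w|\<close> attains both bounds of the triangle inequality,
  and the circle is connected.
\<close>
lemma exists_unit_norm_add:
  fixes z w :: complex
  assumes "\<bar>cmod z - cmod w\<bar> \<le> p" "p \<le> cmod z + cmod w"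
  obtains u where "cmod u = 1" "cmod (u * z + w) = p"
proof -
  let ?f = "\<lambda>u. cmod (u * z + w)"
  obtain u1 where u1: "cmod u1 = 1" "?f u1 = \<bar>cmod z - cmod w\<bar>"
    using exists_unit_aligned[of z "- w"] by auto
  obtain u2 where u2: "cmod u2 = 1" "?f u2 = cmod z + cmod w"
  proof -
    obtain u where u: "cmod u = 1" "cmod (u * z - w) = \<bar>cmod z - cmod w\<bar>"
      by (rule exists_unit_aligned)
    have "(cmod (u * z + w))\<^sup>2 + (cmod (u * z - w))\<^sup>2 = 2 * (cmod (u * z))\<^sup>2 + 2 * (cmod w)\<^sup>2"
      unfolding cmod_power2 by (simp add: power2_eq_square algebra_simps)
    then have "(?f u)\<^sup>2 = (cmod z + cmod w)\<^sup>2"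
      using u by (simp add: norm_mult power2_eq_square algebra_simps)
    then have "?f u = cmod z + cmod w"
      by (simp add: power2_eq_iff_nonneg)
    with u(1) show ?thesis
      using that by blast
  qed
  have "connected (?f ` sphere 0 1)"
    by (intro connected_continuous_image continuous_intros connected_sphere) simp
  moreover have "?f u1 \<in> ?f ` sphere 0 1" "?f u2 \<in> ?f ` sphere 0 1"
    using u1(1) u2(1) by auto
  ultimately have "p \<in> ?f ` sphere 0 1"
    using assms u1(2) u2(2) unfolding connected_iff_interval by metis
  then show ?thesis
    using that by auto
qed

definition S_moduli :: "complex \<Rightarrow> real set" where
  "S_moduli q = closure (range (\<lambda>x. cmod (S_rat x q)))"

text \<open>
  Here \<open>(1 - q) S\<^bsub>2 - 1 / (x + n)\<^esub> = (1 - q) R\<^bsub>x + n\<^esub> = q\<^sup>n T\<^sub>x + S\<^sub>x\<close>, and the powers \<open>q\<^sup>n\<close> come close to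
  every unit. Only large \<open>n\<close> are usable, because the inversion formula needs \<open>x + n > 1\<close>.
\<close>
lemma S_moduli_triangle:
  assumes "cmod q = 1" "\<not> root_of_unity q"
    and "\<bar>cmod (T_rat x q) - cmod (S_rat x q)\<bar> \<le> t * cmod (1 - q)"
    and "t * cmod (1 - q) \<le> cmod (T_rat x q) + cmod (S_rat x q)"
  shows "t \<in> S_moduli q"
proof -
  have q0: "q \<noteq> 0" and q1: "cmod (1 - q) > 0"
    using assms(1,2) by (auto simp: root_of_unity_def)
  obtain m :: nat where "1 - x < of_nat m"
    using ex_less_of_nat_mult[of 1 "1 - x"] by auto
  then have m: "x + of_nat (m + n) > 1" for n
    by (simp add: less_diff_eq)
  obtain u where u: "cmod u = 1" "cmod (u * T_rat x q + S_rat x q) = t * cmod (1 - q)"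
    using exists_unit_norm_add[OF assms(3,4)] by blast
  define f where "f = (\<lambda>v. cmod (v * q ^ m * T_rat x q + S_rat x q) / cmod (1 - q))"
  have "f (q ^ n) = cmod (S_rat (of_int 2 - 1 / (x + of_nat (m + n))) q)" for n
  proof -
    have "(1 - q) * R_rat (x + of_nat (m + n)) q = q ^ (m + n) * T_rat x q + S_rat x q"
      using T_rat_add_nat[OF q0, of x "m + n"] S_rat_add_nat[OF q0, of x "m + n"]
      by (simp only: T_rat_def) (simp add: algebra_simps)
    then have "cmod (1 - q) * cmod (R_rat (x + of_nat (m + n)) q)
        = cmod (q ^ n * q ^ m * T_rat x q + S_rat x q)"
      by (metis add.commute norm_mult power_add)
    then show ?thesis
      unfolding S_rat_inversion[OF q0 m order_refl] f_def using q1 by (simp add: field_simps)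
  qed
  then have "f ` range (\<lambda>n. q ^ n) \<subseteq> range (\<lambda>x. cmod (S_rat x q))"
    by auto
  then have "f ` range (\<lambda>n. q ^ n) \<subseteq> S_moduli q"
    unfolding S_moduli_def using closure_subset by blast
  then have "f ` closure (range (\<lambda>n. q ^ n)) \<subseteq> S_moduli q"
    unfolding f_def S_moduli_def using q1 by (intro image_closure_subset continuous_intros) auto
  moreover have "u / q ^ m \<in> closure (range (\<lambda>n. q ^ n))"
    using assms u(1) by (intro powers_dense_in_circle) (simp_all add: norm_divide norm_power)
  ultimately have "f (u / q ^ m) \<in> S_moduli q"
    by blast
  then show ?thesis
    using u(2) q0 q1 by (simp add: f_def)
qed

text \<open>
  At an integer \<open>|T| = |S| = 1\<close>, so one step reaches every modulus up to \<open>2 / |1 - q| \<ge> 1\<close>.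
\<close>
lemma S_moduli_unit_interval:
  assumes "cmod q = 1" "\<not> root_of_unity q"
  shows "{0..1} \<subseteq> S_moduli q"
proof
  fix t :: real
  assume t: "t \<in> {0..1}"
  have q0: "q \<noteq> 0"
    using assms by auto
  have hj: "hj 2 = [2]"
    by (intro hj_eqI) (simp add: is_hj_def)
  have S: "cmod (S_rat 2 q) = 1"
    using q0 by (simp add: S_rat_gt_1 S_gt1_def hj Let_def)
  have "(cmod (T_rat 2 q))\<^sup>2 = 1"
    using T_S_invariant[OF assms(1), of 2] assms(1)
    unfolding S by (simp add: cmod_one_minus_unit_squared)
  then have T: "cmod (T_rat 2 q) = 1"
    using norm_ge_zero[of "T_rat 2 q"] by (auto simp: power2_eq_1_iff simp del: norm_ge_zero)
  have "cmod (1 - q) \<le> 2"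
    using norm_triangle_ineq4[of 1 q] assms(1) by simp
  then have "t * cmod (1 - q) \<le> 1 * 2"
    using t by (intro mult_mono) auto
  then show "t \<in> S_moduli q"
    using t by (intro S_moduli_triangle[OF assms, of 2]) (simp_all add: S T)
qed

text \<open>
  The largest modulus \<open>|S|\<close> that one inversion, after a rotation of \<open>T\<close>, can produce from a vector
  with \<open>|S| = r\<close>, so that
  \<open>|T| = sqrt (p\<^sup>2 - k r\<^sup>2)\<close>, where \<open>p = |1 - q|\<close> and \<open>k = 1 - 2 Re q = p\<^sup>2 - 1\<close>.
\<close>
definition growth :: "complex \<Rightarrow> real \<Rightarrow> real" where
  "growth q r = (sqrt ((cmod (1 - q))\<^sup>2 - (1 - 2 * Re q) * r\<^sup>2) + r) / cmod (1 - q)"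

lemma continuous_on_growth: "continuous_on A (growth q)"
proof (cases "q = 1")
  case True
  then show ?thesis by (simp add: growth_def[abs_def])
next
  case False
  then show ?thesis
    unfolding growth_def by (intro continuous_intros) auto
qed

lemma growth_0:
  assumes "q \<noteq> 1"
  shows "growth q 0 = 1"
  using assms by (simp add: growth_def)

lemma T_rat_norm:
  assumes "cmod q = 1"
  shows "cmod (T_rat x q) = sqrt ((cmod (1 - q))\<^sup>2 - (1 - 2 * Re q) * (cmod (S_rat x q))\<^sup>2)"
  using T_S_invariant[OF assms, of x] by (intro real_sqrt_unique[symmetric]) (auto simp: algebra_simps)

lemma growth_S_moduli:
  assumes "cmod q = 1" "\<not> root_of_unity q" "r \<in> S_moduli q"
  shows "growth q r \<in> S_moduli q"
proof -
  have q1: "cmod (1 - q) > 0"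
    using assms(2) by (auto simp: root_of_unity_def)
  have "growth q (cmod (S_rat x q)) \<in> S_moduli q" for x
  proof (rule S_moduli_triangle[OF assms(1,2)])
    have "growth q (cmod (S_rat x q)) * cmod (1 - q) = cmod (T_rat x q) + cmod (S_rat x q)"
      using q1 by (simp add: growth_def T_rat_norm[OF assms(1)])
    then show "\<bar>cmod (T_rat x q) - cmod (S_rat x q)\<bar> \<le> growth q (cmod (S_rat x q)) * cmod (1 - q)"
      and "growth q (cmod (S_rat x q)) * cmod (1 - q) \<le> cmod (T_rat x q) + cmod (S_rat x q)"
      by (auto simp: abs_le_iff)
  qed
  then have "growth q ` closure (range (\<lambda>x. cmod (S_rat x q))) \<subseteq> S_moduli q"
    by (intro image_closure_subset continuous_on_growth) (auto simp: S_moduli_def)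
  then show ?thesis
    using assms(3) by (auto simp: S_moduli_def)
qed

text \<open>
  Otherwise let \<open>[0, s]\<close> be the longest initial interval inside \<open>D\<close>; as \<open>g\<close> takes all values between
  \<open>g 0\<close> and \<open>g s > s\<close> on it, \<open>D\<close> contains the longer interval \<open>[0, g s]\<close>.
\<close>
lemma interval_exhausted_by_expansion:
  fixes D :: "real set" and g :: "real \<Rightarrow> real"
  assumes "closed D" "{0..1} \<subseteq> D" "continuous_on {0..b} g"
    and "\<And>r. \<lbrakk>r \<in> D; 0 \<le> r; r \<le> b\<rbrakk> \<Longrightarrow> g r \<in> D"
    and "g 0 \<le> 1" "\<And>r. \<lbrakk>0 \<le> r; r < b\<rbrakk> \<Longrightarrow> r < g r"
  shows "{0..b} \<subseteq> D"
proof (rule ccontr)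
  assume "\<not> {0..b} \<subseteq> D"
  then obtain c where c: "0 \<le> c" "c \<le> b" "c \<notin> D"
    by (auto simp: subset_iff)
  define A where "A = {a. 0 \<le> a \<and> {0..a} \<subseteq> D}"
  define s where "s = Sup A"
  have A_le: "a < c" if "a \<in> A" for a
    using that c by (force simp: A_def simp flip: not_le)
  then have bdd: "bdd_above A"
    by (meson bdd_above.I less_imp_le)
  have "1 \<in> A"
    using assms(2) by (simp add: A_def)
  then have s1: "s \<ge> 1"
    unfolding s_def using bdd by (rule cSup_upper)
  have "{0..<s} \<subseteq> D"
  proof
    fix r
    assume r: "r \<in> {0..<s}"
    then obtain a where "a \<in> A" "r < a"
      using less_cSupD[of A r] \<open>1 \<in> A\<close> by (auto simp: s_def)
    with r show "r \<in> D"
      by (auto simp: A_def)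
  qed
  then have "closure {0..<s} \<subseteq> D"
    using assms(1) by (rule closure_minimal)
  then have s_D: "{0..s} \<subseteq> D"
    using s1 by simp
  then have "s \<in> A"
    using s1 by (simp add: A_def)
  then have "s < c"
    by (rule A_le)
  then have s: "s < b" "s < g s"
    using c s1 assms(6)[of s] by auto
  have "{0..g s} \<subseteq> D"
  proof
    fix t
    assume t: "t \<in> {0..g s}"
    show "t \<in> D"
    proof (cases "t \<le> 1")
      case True
      with t assms(2) show ?thesis by auto
    next
      case False
      then have "\<exists>r. 0 \<le> r \<and> r \<le> s \<and> g r = t"
        using t s s1 assms(5)
        by (intro IVT' continuous_on_subset[OF assms(3)]) auto
      with s_D s assms(4) show ?thesis by force
    qed
  qed
  then have "g s \<in> A"
    using s s1 by (simp add: A_def)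
  then have "g s \<le> s"
    unfolding s_def using bdd by (rule cSup_upper)
  with s show False by simp
qed

text \<open>
  The admissible moduli are those with \<open>k r\<^sup>2 \<le> p\<^sup>2\<close>, since \<open>|T|\<^sup>2 = p\<^sup>2 - k r\<^sup>2\<close>. For \<open>k < 0\<close> the map
  \<open>growth\<close> has no fixed point and the expansion never stops. For \<open>k > 0\<close> (a rotation of the
  sphere) it increases moduli up to \<open>1 / sqrt k\<close>, which it sends to the maximum \<open>p / sqrt k\<close>.
\<close>
lemma S_moduli_full:
  assumes "cmod q = 1" "\<not> root_of_unity q" "Re q \<noteq> 1 / 2"
    and "r \<ge> 0" "(1 - 2 * Re q) * r\<^sup>2 \<le> (cmod (1 - q))\<^sup>2"
  shows "r \<in> S_moduli q"
proof -
  define k where "k = 1 - 2 * Re q"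
  define p where "p = cmod (1 - q)"
  have q1: "q \<noteq> 1"
    using assms(2) by (auto simp: root_of_unity_def)
  then have p: "p > 0" and p2: "p\<^sup>2 = 1 + k"
    using assms(1) by (simp_all add: p_def k_def cmod_one_minus_unit_squared)
  have closed: "closed (S_moduli q)"
    by (simp add: S_moduli_def)
  have g_def: "growth q t = (sqrt (p\<^sup>2 - k * t\<^sup>2) + t) / p" for t
    by (simp add: growth_def p_def k_def)
  have expand: "{0..b} \<subseteq> S_moduli q" if "\<And>t. \<lbrakk>0 \<le> t; t < b\<rbrakk> \<Longrightarrow> t * (p - 1) < sqrt (p\<^sup>2 - k * t\<^sup>2)" for b
  proof (rule interval_exhausted_by_expansion[OF closed S_moduli_unit_interval[OF assms(1,2)]])
    show "continuous_on {0..b} (growth q)"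
      by (rule continuous_on_growth)
    show "growth q t \<in> S_moduli q" if "t \<in> S_moduli q" for t
      using that by (rule growth_S_moduli[OF assms(1,2)])
    show "growth q 0 \<le> 1"
      using growth_0[OF q1] by simp
    show "t < growth q t" if "0 \<le> t" "t < b" for t
      using \<open>\<And>t. \<lbrakk>0 \<le> t; t < b\<rbrakk> \<Longrightarrow> t * (p - 1) < sqrt (p\<^sup>2 - k * t\<^sup>2)\<close>[OF that] p
      by (simp add: g_def field_simps)
  qed
  show ?thesis
  proof (cases "k < 0")
    case True
    then have "p < 1"
      using p p2 power2_less_imp_less[of p 1] by simp
    have "t * (p - 1) < sqrt (p\<^sup>2 - k * t\<^sup>2)" if "t \<ge> 0" for t
    proof -
      have "t * (p - 1) \<le> 0"
        using that \<open>p < 1\<close> by (simp add: mult_nonneg_nonpos)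
      also have "0 < sqrt (p\<^sup>2 - k * t\<^sup>2)"
        using True p by (auto intro!: add_pos_nonneg simp: mult_nonpos_nonneg
            simp flip: add_uminus_conv_diff)
      finally show ?thesis .
    qed
    then have "{0..r} \<subseteq> S_moduli q"
      by (intro expand) auto
    then show ?thesis
      using assms(4) by auto
  next
    case False
    then have k: "k > 0"
      using assms(3) by (simp add: k_def)
    define b where "b = 1 / sqrt k"
    have b: "b > 0" "k * b\<^sup>2 = 1"
      using k by (simp_all add: b_def power_divide)
    have p1: "p > 1" "p \<le> 1 + k"
      using k p p2 power2_less_imp_less[of 1 p] self_le_power[of p 2] by auto
    have "t * (p - 1) < sqrt (p\<^sup>2 - k * t\<^sup>2)" if "0 \<le> t" "t < b" for t
    proof -
      have "t * (p - 1) < b * (p - 1)"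
        using that p1 by simp
      also have "\<dots> \<le> b * k"
        using p1 b by simp
      also have "\<dots> = sqrt k"
        using k by (simp add: b_def real_div_sqrt)
      also have "\<dots> \<le> sqrt (p\<^sup>2 - k * t\<^sup>2)"
      proof -
        have "k * t\<^sup>2 \<le> k * b\<^sup>2"
          using that k by (intro mult_left_mono power_mono) auto
        then show ?thesis
          using b p2 by simp
      qed
      finally show ?thesis .
    qed
    then have b_D: "{0..b} \<subseteq> S_moduli q"
      by (rule expand)
    have g_b: "growth q b = p / sqrt k"
    proof -
      have "growth q b = (sqrt k + 1 / sqrt k) / p"
        using b p2 by (simp add: g_def b_def)
      also have "\<dots> = p\<^sup>2 / sqrt k / p"
        using k by (simp add: p2 field_simps)
      finally show ?thesis
        using p by (simp add: power2_eq_square)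
    qed
    have "(sqrt k * r)\<^sup>2 \<le> p\<^sup>2"
      using assms(5) k by (simp add: power_mult_distrib k_def p_def)
    then have "sqrt k * r \<le> p"
      using p power2_le_imp_le by fastforce
    then have r: "r \<le> growth q b"
      using k by (simp add: g_b field_simps)
    show ?thesis
    proof (cases "r \<le> 1")
      case True
      then show ?thesis
        using assms(4) S_moduli_unit_interval[OF assms(1,2)] by auto
    next
      case False
      then have "\<exists>t. 0 \<le> t \<and> t \<le> b \<and> growth q t = r"
        using r b growth_0[OF q1] by (intro IVT' continuous_on_growth) auto
      then show ?thesis
        using b_D growth_S_moduli[OF assms(1,2)] by auto
    qed
  qed
qed

section \<open>Closures in the projective line\<close>

lemma T_S_approximation:
  assumes "cmod q = 1" "\<not> root_of_unity q" "Re q \<noteq> 1 / 2"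
    and form: "(cmod a)\<^sup>2 + (1 - 2 * Re q) * (cmod b)\<^sup>2 = (cmod (1 - q))\<^sup>2"
    and "e > 0"
  obtains x u where "cmod u = 1" "cmod (u * T_rat x q - a) < e" "cmod (u * S_rat x q - b) < e"
proof -
  have q0: "q \<noteq> 0"
    using assms(1) by auto
  define h where "h = (\<lambda>s. sqrt ((cmod (1 - q))\<^sup>2 - (1 - 2 * Re q) * s\<^sup>2))"
  have h_b: "h (cmod b) = cmod a"
    unfolding h_def using form by (intro real_sqrt_unique) auto
  have "isCont h (cmod b)"
    unfolding h_def by (intro continuous_intros)
  then obtain d where d: "d > 0" "\<And>s. \<bar>s - cmod b\<bar> < d \<Longrightarrow> \<bar>h s - cmod a\<bar> < e / 2"
    using \<open>e > 0\<close> unfolding continuous_at_eps_delta h_b dist_real_def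
    by (metis half_gt_zero)
  have "(1 - 2 * Re q) * (cmod b)\<^sup>2 \<le> (cmod (1 - q))\<^sup>2"
    using form zero_le_power2[of "cmod a"] by linarith
  then have "cmod b \<in> S_moduli q"
    by (intro S_moduli_full assms) auto
  moreover have "min d e > 0"
    using d \<open>e > 0\<close> by simp
  ultimately obtain x where x: "\<bar>cmod (S_rat x q) - cmod b\<bar> < min d e"
    unfolding S_moduli_def closure_approachable dist_real_def by blast
  have "\<bar>cmod (T_rat x q) - cmod a\<bar> < e / 2"
    using d(2)[of "cmod (S_rat x q)"] x unfolding T_rat_norm[OF assms(1)] h_def by simp
  then obtain v where v: "cmod v = 1" "cmod (v * T_rat x q - a) < e / 2"
    using exists_unit_aligned[of "T_rat x q" a] by metis
  obtain u where u: "cmod u = 1" "cmod (u * S_rat x q - b) < e"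
    using exists_unit_aligned[of "S_rat x q" b] x by (metis min_less_iff_conj)
  define M where "M = cmod (T_rat x q) + 1"
  have M: "M > 0" "cmod (T_rat x q) \<le> M"
    by (simp_all add: M_def add_nonneg_pos)
  \<comment> \<open>A translation turns the phase of \<open>T\<close> from the one fitted to \<open>S\<close> to the one fitted to \<open>a\<close>.\<close>
  have "v / u \<in> closure (range (\<lambda>n. q ^ n))"
    using u v by (intro powers_dense_in_circle assms(1,2)) (simp add: norm_divide)
  moreover have "e / (2 * M) > 0"
    using M \<open>e > 0\<close> by simp
  ultimately obtain n where n: "cmod (q ^ n - v / u) < e / (2 * M)"
    unfolding closure_approachable dist_norm by blast
  have "cmod (u * q ^ n * T_rat x q - v * T_rat x q) = cmod (u * (q ^ n - v / u) * T_rat x q)"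
    using u by (auto simp: algebra_simps)
  also have "\<dots> = cmod (q ^ n - v / u) * cmod (T_rat x q)"
    using u by (simp add: norm_mult)
  also have "\<dots> \<le> e / (2 * M) * M"
    using n M \<open>e > 0\<close> by (intro mult_mono) auto
  also have "\<dots> = e / 2"
    using M by simp
  finally have "cmod (u * q ^ n * T_rat x q - a) < e"
    using v(2) norm_triangle_ineq[of "u * q ^ n * T_rat x q - v * T_rat x q" "v * T_rat x q - a"]
    by simp
  then show ?thesis
    using that[of u "x + of_nat n"] u T_rat_add_nat[OF q0] S_rat_add_nat[OF q0]
    by (simp add: mult.assoc)
qed

lemma open_proj_preimage_closure_complement:
  "open {(a, b). (a, b) \<noteq> (0, 0) \<and> proj_point a b \<in> - closure X}"
  using closed_closure[of X] by (simp only: open_Compl flip: open_cp1_def)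

text \<open>
  A vector with positive form can be rescaled so that the form takes its value on the vectors of
  rationals, and then it is a limit of unit multiples of those.
\<close>
lemma positive_form_imp_in_closure:
  assumes "cmod q = 1" "\<not> root_of_unity q" "Re q \<noteq> 1 / 2"
    and pos: "(cmod ((1 - q) * R - S))\<^sup>2 + (1 - 2 * Re q) * (cmod S)\<^sup>2 > 0"
  shows "proj_point R S \<in> closure (X_set q)"
proof (rule ccontr)
  assume contra: "proj_point R S \<notin> closure (X_set q)"
  have q0: "q \<noteq> 0" and q1: "cmod (1 - q) > 0"
    using assms(1,2) by (auto simp: root_of_unity_def)
  define P where "P = (cmod ((1 - q) * R - S))\<^sup>2 + (1 - 2 * Re q) * (cmod S)\<^sup>2"
  define l where "l = cmod (1 - q) / sqrt P"
  have P: "P > 0"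
    using pos by (simp add: P_def)
  have l: "l > 0" "l\<^sup>2 * P = (cmod (1 - q))\<^sup>2"
    using P q1 by (simp_all add: l_def power_divide)
  have RS: "(R, S) \<noteq> (0, 0)"
    using pos by auto
  define W where "W = {(a, b). (a, b) \<noteq> (0, 0) \<and> proj_point a b \<in> - closure (X_set q)}"
  have "open W"
    unfolding W_def by (rule open_proj_preimage_closure_complement)
  moreover have "(l * R, l * S) \<in> W"
  proof -
    have "proj_point (l * R) (l * S) = proj_point R S"
      using RS l by (subst proj_point_eq_iff) auto
    then show ?thesis
      using RS l contra by (auto simp: W_def)
  qed
  ultimately obtain e where e: "e > 0" "ball (l * R, l * S) e \<subseteq> W"
    using open_contains_ball by blast
  define a where "a = of_real l * ((1 - q) * R - S)"
  define d where "d = e / (1 + 2 / cmod (1 - q))"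
  have d: "d > 0" "d * (1 + 2 / cmod (1 - q)) = e"
    using e q1 by (simp_all add: d_def add_pos_pos less_imp_neq[THEN not_sym])
  have "(cmod a)\<^sup>2 + (1 - 2 * Re q) * (cmod (of_real l * S))\<^sup>2 = l\<^sup>2 * P"
    unfolding a_def P_def norm_mult norm_of_real power_mult_distrib power2_abs distrib_left
    by simp
  then obtain x u where xu: "cmod u = 1" "cmod (u * T_rat x q - a) < d"
      "cmod (u * S_rat x q - of_real l * S) < d"
    using T_S_approximation[OF assms(1-3), of a "of_real l * S" d] l d by metis
  have "(1 - q) * (u * R_rat x q - l * R) = (u * T_rat x q - a) + (u * S_rat x q - l * S)"
    by (simp add: a_def T_rat_def algebra_simps)
  then have "cmod (1 - q) * cmod (u * R_rat x q - l * R)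
      \<le> cmod (u * T_rat x q - a) + cmod (u * S_rat x q - l * S)"
    by (metis norm_mult norm_triangle_ineq)
  also have "\<dots> < 2 * d"
    using xu by simp
  finally have "cmod (u * R_rat x q - l * R) < 2 * d / cmod (1 - q)"
    using q1 by (simp add: field_simps)
  then have "cmod (u * R_rat x q - l * R) + cmod (u * S_rat x q - l * S) < e"
    using xu(3) d(2) by (simp add: algebra_simps)
  then have "dist (u * R_rat x q, u * S_rat x q) (l * R, l * S) < e"
    unfolding dist_Pair_Pair dist_norm[where 'a = complex]
    by (rule le_less_trans[OF sqrt_sum_squares_le_sum[OF norm_ge_zero norm_ge_zero]])
  then have "(u * R_rat x q, u * S_rat x q) \<in> W"
    using e(2) by (auto simp: dist_commute)
  moreover have "proj_point (u * R_rat x q) (u * S_rat x q) = q_rat x q"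
    unfolding q_rat_def using R_S_nonzero[OF q0, of x] xu(1)
    by (subst proj_point_eq_iff) auto
  ultimately show False
    using closure_subset[of "X_set q"] by (auto simp: W_def X_set_def)
qed

lemma C_minus_closure:
  assumes "q \<in> C_minus" "\<not> root_of_unity q" "Re q \<noteq> 1 / 2"
  shows "closure (X_set q) = UNIV"
proof -
  have q: "cmod q = 1" "Re q < 1 / 2" and q1: "q \<noteq> 1"
    using assms by (auto simp: C_minus_def root_of_unity_def)
  have "z \<in> closure (X_set q)" for z
  proof -
    obtain R S where RS: "(R, S) \<noteq> (0, 0)" "z = proj_point R S"
      by (rule proj_point_exhaust)
    have "(cmod ((1 - q) * R - S))\<^sup>2 + (1 - 2 * Re q) * (cmod S)\<^sup>2 > 0"
    proof (cases "S = 0")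
      case True
      then show ?thesis using RS q1 by simp
    next
      case False
      then show ?thesis using q by (intro add_nonneg_pos) auto
    qed
    then show ?thesis
      unfolding RS(2) by (rule positive_form_imp_in_closure[OF q(1) assms(2,3)])
  qed
  then show ?thesis by blast
qed

text \<open>The complement of the disk \<open>|(1 - q) z - 1| < c\<close> in the projective line.\<close>
definition disk_exterior :: "complex \<Rightarrow> real \<Rightarrow> cp1 set" where
  "disk_exterior q c = insert cp1_infinity (cp1_of ` {z. cmod ((1 - q) * z - 1) \<ge> c})"

lemma proj_point_in_disk_exterior_iff:
  assumes "(R, S) \<noteq> (0, 0)"
  shows "proj_point R S \<in> disk_exterior q c \<longleftrightarrow> c * cmod S \<le> cmod ((1 - q) * R - S)"
proof (cases "S = 0")
  case True
  then show ?thesis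
    using assms by (simp add: disk_exterior_def cp1_infinity_def proj_point_eq_iff)
next
  case False
  have "proj_point R S \<noteq> cp1_infinity"
    using False assms by (simp add: cp1_infinity_def proj_point_eq_iff)
  moreover have "proj_point R S = cp1_of z \<longleftrightarrow> z = R / S" for z
    using False assms by (auto simp: cp1_of_def proj_point_eq_iff nonzero_eq_divide_eq mult.commute)
  ultimately have "proj_point R S \<in> disk_exterior q c \<longleftrightarrow> c \<le> cmod ((1 - q) * (R / S) - 1)"
    by (auto simp: disk_exterior_def image_iff)
  also have "cmod ((1 - q) * (R / S) - 1) = cmod ((1 - q) * R - S) / cmod S"
    using False by (simp add: diff_divide_distrib flip: norm_divide)
  finally show ?thesis
    using False by (simp add: field_simps)
qed

lemma closed_disk_exterior: "closed (disk_exterior q c)"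
proof -
  have "{(a, b). (a, b) \<noteq> (0, 0) \<and> proj_point a b \<in> - disk_exterior q c}
      = {v. cmod ((1 - q) * fst v - snd v) < c * cmod (snd v)}"
  proof (intro set_eqI)
    fix v :: "complex \<times> complex"
    show "v \<in> {(a, b). (a, b) \<noteq> (0, 0) \<and> proj_point a b \<in> - disk_exterior q c}
      \<longleftrightarrow> v \<in> {v. cmod ((1 - q) * fst v - snd v) < c * cmod (snd v)}"
      using proj_point_in_disk_exterior_iff[of "fst v" "snd v" q c]
      by (cases "v = (0, 0)") (auto simp: case_prod_beta not_le)
  qed
  moreover have "open {v :: complex \<times> complex. cmod ((1 - q) * fst v - snd v) < c * cmod (snd v)}"
    by (intro open_Collect_less continuous_intros)
  ultimately show ?thesis
    unfolding closed_def open_cp1_def by simp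
qed

text \<open>
  On the boundary circle the form vanishes, but such a point is the limit of the points obtained by
  enlarging \<open>T = (1 - q) R - S\<close>, where the form is positive.
\<close>
lemma C_plus_closure:
  assumes "q \<in> C_plus" "\<not> root_of_unity q"
  shows "closure (X_set q) = disk_exterior q (sqrt (2 * Re q - 1))"
proof
  have q: "cmod q = 1" "Re q > 1 / 2" and q0: "q \<noteq> 0" and q1: "1 - q \<noteq> 0"
    using assms by (auto simp: C_plus_def root_of_unity_def)
  have "q_rat x q \<in> disk_exterior q (sqrt (2 * Re q - 1))" for x
    unfolding q_rat_def proj_point_in_disk_exterior_iff[OF R_S_nonzero[OF q0]]
    using T_S_lower_bound[OF assms(1), of x] by (simp add: T_rat_def)
  then show "closure (X_set q) \<subseteq> disk_exterior q (sqrt (2 * Re q - 1))"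
    by (intro closure_minimal closed_disk_exterior) (auto simp: X_set_def)
  show "disk_exterior q (sqrt (2 * Re q - 1)) \<subseteq> closure (X_set q)"
  proof (rule subsetI, rule ccontr)
    fix z
    assume z: "z \<in> disk_exterior q (sqrt (2 * Re q - 1))" "z \<notin> closure (X_set q)"
    obtain R S where RS: "(R, S) \<noteq> (0, 0)" "z = proj_point R S"
      by (rule proj_point_exhaust)
    define T where "T = (1 - q) * R - S"
    have "sqrt (2 * Re q - 1) * cmod S \<le> cmod T"
      using z(1) unfolding RS(2) proj_point_in_disk_exterior_iff[OF RS(1)] T_def .
    then have "(sqrt (2 * Re q - 1) * cmod S)\<^sup>2 \<le> (cmod T)\<^sup>2"
      using q(2) by (intro power_mono) auto
    then have form: "(2 * Re q - 1) * (cmod S)\<^sup>2 \<le> (cmod T)\<^sup>2"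
      using q(2) by (simp add: power_mult_distrib)
    have "T \<noteq> 0"
    proof
      assume T0: "T = 0"
      then have "S = 0"
        using form q(2) by (simp add: mult_le_0_iff)
      then show False
        using T0 RS(1) q1 by (simp add: T_def)
    qed
    define W where "W = {(a, b). (a, b) \<noteq> (0, 0) \<and> proj_point a b \<in> - closure (X_set q)}"
    have W: "open W"
      unfolding W_def by (rule open_proj_preimage_closure_complement)
    define f where "f = (\<lambda>t. (R + of_real t * (T / (1 - q)), S))"
    have "(f \<longlongrightarrow> f 0) (at_right 0)"
      unfolding f_def by (intro tendsto_intros)
    moreover have "f 0 \<in> W"
      using RS z(2) by (simp add: f_def W_def)
    ultimately have "\<forall>\<^sub>F t in at_right 0. f t \<in> W"
      using W topological_tendstoD by blast
    then have "\<forall>\<^sub>F t in at_right 0. f t \<in> W \<and> t > 0"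
      using eventually_at_right_less by (rule eventually_conj)
    then obtain t where t: "f t \<in> W" "t > 0"
      using eventually_happens'[OF trivial_limit_at_right_real] by blast
    have T': "(1 - q) * (R + of_real t * (T / (1 - q))) - S = of_real (1 + t) * T"
      using q1 by (simp add: T_def field_simps)
    have "(2 * Re q - 1) * (cmod S)\<^sup>2 \<le> (cmod T)\<^sup>2"
      by (rule form)
    also have "\<dots> < ((1 + t) * cmod T)\<^sup>2"
      using t \<open>T \<noteq> 0\<close> by (intro power_strict_mono) auto
    also have "\<dots> = (cmod (of_real (1 + t) * T))\<^sup>2"
      using t by (simp only: norm_mult norm_of_real)
    finally have "0 < (cmod (of_real (1 + t) * T))\<^sup>2 + (1 - 2 * Re q) * (cmod S)\<^sup>2"
      by (simp add: algebra_simps)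
    then have "proj_point (R + of_real t * (T / (1 - q))) S \<in> closure (X_set q)"
      using q(2) unfolding T'[symmetric] by (intro positive_form_imp_in_closure q(1) assms(2)) auto
    then show False
      using t(1) by (simp add: f_def W_def)
  qed
qed

text \<open>
  The ratio \<open>|T|\<^sup>2 / |S|\<^sup>2 = (2 Re q - 1) + |1 - q|\<^sup>2 / |S|\<^sup>2\<close> comes arbitrarily close to \<open>2 Re q - 1\<close>
  because \<open>|S|\<close> is unbounded.
\<close>
lemma C_plus_sharp:
  assumes "q \<in> C_plus" "\<not> root_of_unity q"
    and C: "\<And>x. C * cmod (S_rat x q) \<le> cmod (T_rat x q)"
  shows "C \<le> sqrt (2 * Re q - 1)"
proof (rule ccontr)
  assume contra: "\<not> C \<le> sqrt (2 * Re q - 1)"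
  have q: "cmod q = 1" "Re q > 1 / 2"
    using assms by (auto simp: C_plus_def)
  define d where "d = C\<^sup>2 - (2 * Re q - 1)"
  have "sqrt (2 * Re q - 1) < C" "0 \<le> sqrt (2 * Re q - 1)"
    using contra q(2) by auto
  then have C0: "C > 0" and "(sqrt (2 * Re q - 1))\<^sup>2 < C\<^sup>2"
    by (linarith, intro power_strict_mono) auto
  then have d: "d > 0"
    using q(2) by (simp add: d_def)
  define r where "r = cmod (1 - q) / sqrt d + 1"
  have "r \<ge> 0"
    using d by (simp add: r_def add_nonneg_nonneg)
  moreover have "(1 - 2 * Re q) * r\<^sup>2 \<le> 0"
    using q(2) by (simp add: mult_nonpos_nonneg)
  then have "(1 - 2 * Re q) * r\<^sup>2 \<le> (cmod (1 - q))\<^sup>2"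
    using zero_le_power2[of "cmod (1 - q)"] by linarith
  ultimately have "r \<in> S_moduli q"
    using q by (intro S_moduli_full assms(2)) auto
  then obtain x where "\<bar>cmod (S_rat x q) - r\<bar> < 1"
    unfolding S_moduli_def closure_approachable dist_real_def by (auto dest: spec[of _ 1])
  then have "cmod (1 - q) / sqrt d < cmod (S_rat x q)"
    by (simp add: r_def)
  then have "cmod (1 - q) < sqrt d * cmod (S_rat x q)"
    using d by (simp add: field_simps)
  then have "(cmod (1 - q))\<^sup>2 < (sqrt d * cmod (S_rat x q))\<^sup>2"
    by (intro power_strict_mono) auto
  then have "(cmod (1 - q))\<^sup>2 < d * (cmod (S_rat x q))\<^sup>2"
    using d by (simp add: power_mult_distrib)
  moreover have "(C * cmod (S_rat x q))\<^sup>2 \<le> (cmod (T_rat x q))\<^sup>2"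
    using C[of x] C0 by (intro power_mono) auto
  then have "d * (cmod (S_rat x q))\<^sup>2 \<le> (cmod (1 - q))\<^sup>2"
    using T_S_invariant[OF q(1), of x] by (simp add: d_def power_mult_distrib algebra_simps)
  ultimately show False by simp
qed

text \<open>On the unit circle \<open>Re q = 1 / 2\<close> means \<open>q\<^sup>2 - q + 1 = 0\<close>, so that \<open>q\<^sup>3 = - 1\<close>.\<close>
lemma Re_half_imp_root_of_unity:
  assumes "cmod q = 1" "Re q = 1 / 2"
  shows "root_of_unity q"
proof -
  have "q + cnj q = 1"
    using assms(2) by (simp add: complex_eq_iff)
  moreover have "q * cnj q = 1"
    using complex_norm_square[of q] assms(1) by simp
  ultimately have "q * (1 - q) = 1"
    by (metis add_diff_cancel_left')
  then have "q\<^sup>2 = q - 1"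
    by (simp add: power2_eq_square algebra_simps)
  then have "q ^ 3 = -1"
    unfolding power2_eq_square power3_eq_cube by algebra
  then have "(q ^ 3)\<^sup>2 = 1"
    by simp
  then have "q ^ 6 = 1"
    by (simp flip: power_mult)
  then show ?thesis
    unfolding root_of_unity_def by (intro exI[of _ 6]) simp
qed

theorem theorem7p1:
  fixes q :: complex
  assumes "cmod q = 1"
  shows
    "(q \<in> C_minus \<longrightarrow>
        (\<forall>x. cmod (T_rat x q) + Re (1 - inverse q - q) * cmod (S_rat x q) \<le> cmod (1 - q) ^ 3)) \<and>
     (q \<in> {exp (\<i> * of_real pi / 3), exp (- \<i> * of_real pi / 3)} \<longrightarrow>
        (\<forall>x. cmod (T_rat x q) = 1)) \<and>
     (q \<in> C_plus \<longrightarrow>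
        (\<forall>x. cmod (T_rat x q) \<ge> sqrt (Re (q + inverse q - 1)) * cmod (S_rat x q)) \<and>
        (\<forall>x. S_rat x q \<noteq> 0 \<longrightarrow>
           cmod ((1 - q) * (R_rat x q / S_rat x q) - 1) \<ge> sqrt (Re (q + inverse q - 1)))) \<and>
     (\<not> root_of_unity q \<longrightarrow>
        (q \<in> C_minus \<longrightarrow> closure (X_set q) = UNIV) \<and>
        (q \<in> C_plus \<longrightarrow>
           closure (X_set q) =
             insert cp1_infinity
               (cp1_of ` {z. cmod ((1 - q) * z - 1) \<ge> sqrt (Re (q + inverse q - 1))}) \<and>
           cp1_of ` {z. cmod ((1 - q) * z - 1) = sqrt (Re (q + inverse q - 1))}
             \<subseteq> closure (X_set q) \<and>
           (\<forall>C::real. (\<forall>x. cmod (T_rat x q) \<ge> C * cmod (S_rat x q)) \<longrightarrow>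
              C \<le> sqrt (Re (q + inverse q - 1)))))"
proof -
  have k: "Re (1 - inverse q - q) = 1 - 2 * Re q"
    and c: "Re (q + inverse q - 1) = 2 * Re q - 1"
    using inverse_unit[OF assms] by simp_all
  have endpoints: "cmod (T_rat x q) = 1"
    if "q \<in> {exp (\<i> * of_real pi / 3), exp (- \<i> * of_real pi / 3)}" for x
  proof -
    have "Re q = 1 / 2"
      using that by (auto simp: Re_exp cos_60)
    then have k0: "1 - 2 * Re q = 0" and p: "(cmod (1 - q))\<^sup>2 = 1"
      using cmod_one_minus_unit_squared[OF assms] by simp_all
    show ?thesis
      unfolding T_rat_norm[OF assms] k0 p by simp
  qed
  have affine: "sqrt (2 * Re q - 1) \<le> cmod ((1 - q) * (R_rat x q / S_rat x q) - 1)"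
    if "q \<in> C_plus" "S_rat x q \<noteq> 0" for x
  proof -
    have "cmod ((1 - q) * (R_rat x q / S_rat x q) - 1) = cmod (T_rat x q) / cmod (S_rat x q)"
      using that(2) by (simp add: T_rat_def diff_divide_distrib flip: norm_divide)
    also have "sqrt (2 * Re q - 1) \<le> \<dots>"
      using T_S_lower_bound[OF that(1), of x] that(2) by (simp add: pos_le_divide_eq)
    finally show ?thesis .
  qed
  have circle: "cp1_of ` {z. cmod ((1 - q) * z - 1) = sqrt (2 * Re q - 1)} \<subseteq> closure (X_set q)"
    if "q \<in> C_plus" "\<not> root_of_unity q"
    unfolding C_plus_closure[OF that] disk_exterior_def by auto
  have minus: "closure (X_set q) = UNIV" if "q \<in> C_minus" "\<not> root_of_unity q"
    using C_minus_closure[OF that] Re_half_imp_root_of_unity[OF assms] that(2) by blast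
  show ?thesis
    unfolding k c
    by (intro conjI impI allI;
        rule T_S_upper_bound T_S_lower_bound endpoints affine minus circle C_plus_sharp
          C_plus_closure[unfolded disk_exterior_def];
        (assumption | erule spec))
qed

end
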